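(* There is an algorithm that, given a matching market in the $d$-list model and a perfect matching $\mu$, decides whether $\mu$ is stable in $O(dn)$ time.
   Context: A matching market consists of $n$ men and $n$ women. In the $d$-list model there are $d$ rankings $\pi_1,\dots,\pi_d$ of the women and $d$ rankings $\sigma_1,\dots,\sigma_d$ of the men; each man uses one of the $\pi_i$ as his preference list and each woman uses one of the $\sigma_j$ as hers, so the input has size $O(dn)$. A perfect matching $\mu$ is stable if there is no pair $(m,w)\notin\mu$ such that $w$ appears before $\mu(m)$ in $m$'s list and $m$ appears before $\mu(w)$ in $w$'s list. *)

theory Defs
  imports Main
begin

section \<open>Matching markets in the d-list model\<close>

text \<open>
  Men and women are both numbered by {..<n}, and the lists on either side by {..<d}.
  Only the values of the functions on these index sets are meaningful.
\<close>

record market =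
  women_ranking :: "nat \<Rightarrow> nat list"  \<comment> \<open>the lists \<pi>, most preferred woman first\<close>
  men_ranking :: "nat \<Rightarrow> nat list"    \<comment> \<open>the lists \<sigma>, most preferred man first\<close>
  man_list :: "nat \<Rightarrow> nat"            \<comment> \<open>index of the list \<pi> used by a man\<close>
  woman_list :: "nat \<Rightarrow> nat"          \<comment> \<open>index of the list \<sigma> used by a woman\<close>

definition ranking :: "nat \<Rightarrow> nat list \<Rightarrow> bool" where
  "ranking n xs \<longleftrightarrow> distinct xs \<and> set xs = {..<n}"

definition d_list_market :: "nat \<Rightarrow> nat \<Rightarrow> market \<Rightarrow> bool" where
  "d_list_market n d M \<longleftrightarrow>
     (\<forall>i<d. ranking n (women_ranking M i)) \<and> (\<forall>j<d. ranking n (men_ranking M j)) \<and>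
     (\<forall>m<n. man_list M m < d) \<and> (\<forall>w<n. woman_list M w < d)"

definition man_pref :: "market \<Rightarrow> nat \<Rightarrow> nat list" where
  "man_pref M m = women_ranking M (man_list M m)"

definition woman_pref :: "market \<Rightarrow> nat \<Rightarrow> nat list" where
  "woman_pref M w = men_ranking M (woman_list M w)"

definition appears_before :: "'a \<Rightarrow> 'a \<Rightarrow> 'a list \<Rightarrow> bool" where
  "appears_before x y xs \<longleftrightarrow> (\<exists>i j. i < j \<and> j < length xs \<and> xs ! i = x \<and> xs ! j = y)"

text \<open>A perfect matching is given by the function sending each man to his partner.\<close>

definition perfect_matching :: "nat \<Rightarrow> (nat \<Rightarrow> nat) \<Rightarrow> bool" where
  "perfect_matching n \<mu> \<longleftrightarrow> bij_betw \<mu> {..<n} {..<n}"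

definition partner_of_woman :: "nat \<Rightarrow> (nat \<Rightarrow> nat) \<Rightarrow> nat \<Rightarrow> nat" where
  "partner_of_woman n \<mu> w = inv_into {..<n} \<mu> w"

definition blocking_pair :: "nat \<Rightarrow> market \<Rightarrow> (nat \<Rightarrow> nat) \<Rightarrow> nat \<Rightarrow> nat \<Rightarrow> bool" where
  "blocking_pair n M \<mu> m w \<longleftrightarrow>
     \<mu> m \<noteq> w \<and>
     appears_before w (\<mu> m) (man_pref M m) \<and>
     appears_before m (partner_of_woman n \<mu> w) (woman_pref M w)"

definition stable_matching :: "nat \<Rightarrow> market \<Rightarrow> (nat \<Rightarrow> nat) \<Rightarrow> bool" where
  "stable_matching n M \<mu> \<longleftrightarrow> \<not> (\<exists>m<n. \<exists>w<n. blocking_pair n M \<mu> m w)"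

section \<open>Word RAM programs\<close>

text \<open>
  Structured programs on a random access machine with b-bit words. Registers are named by
  numbers (a program mentions finitely many); the memory is addressed through registers.
  Every assignment, memory access and test takes one unit of time. Addition is modulo
  2 ^ b, subtraction is truncated at 0, and there is no multiplication.
\<close>

type_synonym reg_name = nat

datatype test = Less reg_name reg_name | Equal reg_name reg_name

datatype com =
    Skip
  | Const reg_name nat
  | Move reg_name reg_name
  | Add reg_name reg_name reg_name
  | Sub reg_name reg_name reg_name
  | Load reg_name reg_name   \<comment> \<open>target register, register holding the address\<close>
  | Store reg_name reg_name  \<comment> \<open>register holding the address, source register\<close>
  | Seq com com
  | Cond test com com
  | While test com

record ram_state =
  reg :: "reg_name \<Rightarrow> nat"
  mem :: "nat \<Rightarrow> nat"

fun holds :: "test \<Rightarrow> ram_state \<Rightarrow> bool" where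
  "holds (Less x y) s \<longleftrightarrow> reg s x < reg s y"
| "holds (Equal x y) s \<longleftrightarrow> reg s x = reg s y"

definition set_reg :: "nat \<Rightarrow> reg_name \<Rightarrow> nat \<Rightarrow> ram_state \<Rightarrow> ram_state" where
  "set_reg b x v s = s\<lparr>reg := (reg s)(x := v mod 2 ^ b)\<rparr>"

text \<open>exec b c s t s': on b-bit words, c started in s terminates in s' after t time units.\<close>

inductive exec :: "nat \<Rightarrow> com \<Rightarrow> ram_state \<Rightarrow> nat \<Rightarrow> ram_state \<Rightarrow> bool" for b :: nat where
  Skip: "exec b Skip s 1 s"
| Const: "exec b (Const x k) s 1 (set_reg b x k s)"
| Move: "exec b (Move x y) s 1 (set_reg b x (reg s y) s)"
| Add: "exec b (Add x y z) s 1 (set_reg b x (reg s y + reg s z) s)"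
| Sub: "exec b (Sub x y z) s 1 (set_reg b x (reg s y - reg s z) s)"
| Load: "exec b (Load x a) s 1 (set_reg b x (mem s (reg s a)) s)"
| Store: "exec b (Store a x) s 1 (s\<lparr>mem := (mem s)(reg s a := reg s x)\<rparr>)"
| Seq: "exec b c1 s t1 s1 \<Longrightarrow> exec b c2 s1 t2 s2 \<Longrightarrow> exec b (Seq c1 c2) s (t1 + t2) s2"
| CondTrue: "holds e s \<Longrightarrow> exec b c1 s t s' \<Longrightarrow> exec b (Cond e c1 c2) s (1 + t) s'"
| CondFalse: "\<not> holds e s \<Longrightarrow> exec b c2 s t s' \<Longrightarrow> exec b (Cond e c1 c2) s (1 + t) s'"
| WhileTrue: "holds e s \<Longrightarrow> exec b c s t1 s1 \<Longrightarrow> exec b (While e c) s1 t2 s2 \<Longrightarrow>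
    exec b (While e c) s (1 + t1 + t2) s2"
| WhileFalse: "\<not> holds e s \<Longrightarrow> exec b (While e c) s 1 s"

inductive_cases exec_elims:
  "exec b Skip s t s'" "exec b (Const x k) s t s'" "exec b (Move x y) s t s'"
  "exec b (Add x y z) s t s'" "exec b (Sub x y z) s t s'" "exec b (Load x y) s t s'"
  "exec b (Store x y) s t s'"
inductive_cases exec_SeqE: "exec b (Seq c1 c2) s t s'"
inductive_cases exec_CondE: "exec b (Cond e c1 c2) s t s'"
inductive_cases exec_WhileE: "exec b (While e c) s t s'"

lemma exec_deterministic:
  "exec b c s t s' \<Longrightarrow> exec b c s t' s'' \<Longrightarrow> t' = t \<and> s'' = s'"
proof (induction arbitrary: t' s'' rule: exec.induct)
  case (Seq c1 s t1 s1 c2 t2 s2)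
  from Seq.prems show ?case
    by (rule exec_SeqE) (auto dest!: Seq.IH)
next
  case (CondTrue e s c1 t s1 c2)
  from CondTrue.prems show ?case
    by (rule exec_CondE) (use CondTrue.hyps(1) in \<open>auto dest!: CondTrue.IH\<close>)
next
  case (CondFalse e s c2 t s1 c1)
  from CondFalse.prems show ?case
    by (rule exec_CondE) (use CondFalse.hyps(1) in \<open>auto dest!: CondFalse.IH\<close>)
next
  case (WhileTrue e s c t1 s1 t2 s2)
  from WhileTrue.prems show ?case
    by (rule exec_WhileE) (use WhileTrue.hyps(1) in \<open>auto dest!: WhileTrue.IH\<close>)
next
  case (WhileFalse e s c)
  from WhileFalse.prems show ?case
    by (rule exec_WhileE) (use WhileFalse.hyps in auto)
qed (elim exec_elims, simp)+

text \<open>The input occupies the memory from address 0 on; everything else is initially 0.\<close>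

definition initial_state :: "nat list \<Rightarrow> ram_state" where
  "initial_state xs = \<lparr>reg = (\<lambda>_. 0), mem = (\<lambda>a. if a < length xs then xs ! a else 0)\<rparr>"

text \<open>The answer is left in register 0: 1 for yes, 0 for no.\<close>

definition decides_within :: "nat \<Rightarrow> com \<Rightarrow> nat list \<Rightarrow> bool \<Rightarrow> nat \<Rightarrow> bool" where
  "decides_within b p xs Q T \<longleftrightarrow>
     (\<exists>t s. exec b p (initial_state xs) t s \<and> t \<le> T \<and> reg s 0 = (if Q then 1 else 0))"

definition encode_input :: "nat \<Rightarrow> nat \<Rightarrow> market \<Rightarrow> (nat \<Rightarrow> nat) \<Rightarrow> nat list" where
  "encode_input n d M \<mu> =
     [n, d] @ concat (map (women_ranking M) [0..<d]) @ concat (map (men_ranking M) [0..<d]) @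
     map (man_list M) [0..<n] @ map (woman_list M) [0..<n] @ map \<mu> [0..<n]"

end

theory Submission
  imports Defs
begin

text \<open>
  Fix a list \<pi> i and read it from the least to the most preferred woman. While doing so, keep for every list
  \<sigma> j the best \<sigma> j-rank among the men who use \<pi> i and whose partner has already been passed. A woman w who
  uses \<sigma> j belongs to a blocking pair with a man using \<pi> i iff, at the moment w is reached, this best rank
  is better than the rank of her partner. Each list costs O(n) probes, plus O(d) for every man entering the
  table. Since each man enters only once, in the sweep of his own list, all entries together cost O(dn).
\<close>

section \<open>Weakest preconditions with running time\<close>

text \<open>A man prefers w to his partner iff that partner stands after w in his list. So, when w
  is reached from the end of a list, the men already entered are exactly those using this list who
  prefer w, and one of them blocks with w iff the best of them in w's ranking beats w's partner.
  Hence one number per list \<sigma> suffices. The obstacle is the budget: d may be smaller or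
  larger than n, so neither n * n pairs of persons nor d * d pairs of lists can be visited. Within
  the sweeps, work of order d is done only on behalf of a single man, and the bounds are amortized:
  the number of men entered so far acts as a potential with factor \<open>8 * d + 4\<close>, the
  cost of one entry. As the machine cannot multiply, an address of the form base + j * n is reached
  by a running pointer or looked up in a table.\<close>

text \<open>The last argument of the postcondition is the time elapsed so far, carried along as a ghost value, so that
  loop invariants can bound the running time like any other quantity.\<close>

definition wp ::
  "nat \<Rightarrow> com \<Rightarrow> ((reg_name \<Rightarrow> nat) \<Rightarrow> (nat \<Rightarrow> nat) \<Rightarrow> nat \<Rightarrow> bool) \<Rightarrow>
   (reg_name \<Rightarrow> nat) \<Rightarrow> (nat \<Rightarrow> nat) \<Rightarrow> nat \<Rightarrow> bool" where
  "wp b c Q r m t \<longleftrightarrow>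
     (\<exists>t' s'. exec b c \<lparr>reg = r, mem = m\<rparr> t' s' \<and> Q (reg s') (mem s') (t + t'))"

abbreviation seq :: "com \<Rightarrow> com \<Rightarrow> com" (infixr ";;" 60) where
  "c ;; c' \<equiv> Seq c c'"

lemma exec_basic_iff:
  "exec b Skip s t s' \<longleftrightarrow> t = 1 \<and> s' = s"
  "exec b (Const x k) s t s' \<longleftrightarrow> t = 1 \<and> s' = set_reg b x k s"
  "exec b (Move x y) s t s' \<longleftrightarrow> t = 1 \<and> s' = set_reg b x (reg s y) s"
  "exec b (Add x y z) s t s' \<longleftrightarrow> t = 1 \<and> s' = set_reg b x (reg s y + reg s z) s"
  "exec b (Sub x y z) s t s' \<longleftrightarrow> t = 1 \<and> s' = set_reg b x (reg s y - reg s z) s"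
  "exec b (Load x a) s t s' \<longleftrightarrow> t = 1 \<and> s' = set_reg b x (mem s (reg s a)) s"
  "exec b (Store a x) s t s' \<longleftrightarrow> t = 1 \<and> s' = s\<lparr>mem := (mem s)(reg s a := reg s x)\<rparr>"
  by (auto simp del: One_nat_def intro: exec.intros elim: exec_elims)

lemma wp_basic [simp]:
  "wp b Skip Q r m t \<longleftrightarrow> Q r m (t + 1)"
  "wp b (Const x k) Q r m t \<longleftrightarrow> Q (r(x := k mod 2 ^ b)) m (t + 1)"
  "wp b (Move x y) Q r m t \<longleftrightarrow> Q (r(x := r y mod 2 ^ b)) m (t + 1)"
  "wp b (Add x y z) Q r m t \<longleftrightarrow> Q (r(x := (r y + r z) mod 2 ^ b)) m (t + 1)"
  "wp b (Sub x y z) Q r m t \<longleftrightarrow> Q (r(x := (r y - r z) mod 2 ^ b)) m (t + 1)"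
  "wp b (Load x a) Q r m t \<longleftrightarrow> Q (r(x := m (r a) mod 2 ^ b)) m (t + 1)"
  "wp b (Store a x) Q r m t \<longleftrightarrow> Q r (m(r a := r x)) (t + 1)"
  by (simp_all add: wp_def exec_basic_iff set_reg_def)

lemma ram_state_eta [simp]: "\<lparr>reg = reg s, mem = mem s\<rparr> = (s :: ram_state)"
  by simp

lemma exec_Seq_iff:
  "exec b (Seq c c') s t s' \<longleftrightarrow> (\<exists>t1 s1 t2. t = t1 + t2 \<and> exec b c s t1 s1 \<and> exec b c' s1 t2 s')"
  by (subst exec.simps) auto

lemma exec_Cond_iff:
  "exec b (Cond e c c') s t s' \<longleftrightarrow>
     (\<exists>t1. t = 1 + t1 \<and> (if holds e s then exec b c s t1 s' else exec b c' s t1 s'))"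
  by (subst exec.simps) auto

lemma wp_Seq [simp]: "wp b (Seq c c') Q r m t \<longleftrightarrow> wp b c (wp b c' Q) r m t"
proof
  assume "wp b (Seq c c') Q r m t"
  then obtain t1 s1 t2 s2 where "exec b c \<lparr>reg = r, mem = m\<rparr> t1 s1" "exec b c' s1 t2 s2"
    "Q (reg s2) (mem s2) (t + (t1 + t2))"
    unfolding wp_def exec_Seq_iff by auto
  then have "wp b c' Q (reg s1) (mem s1) (t + t1)"
    unfolding wp_def ram_state_eta by (metis add.assoc)
  then show "wp b c (wp b c' Q) r m t"
    unfolding wp_def[of b c] using \<open>exec b c _ t1 s1\<close> by blast
next
  assume "wp b c (wp b c' Q) r m t"
  then obtain t1 s1 where 1: "exec b c \<lparr>reg = r, mem = m\<rparr> t1 s1" "wp b c' Q (reg s1) (mem s1) (t + t1)"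
    unfolding wp_def[of b c] by blast
  then obtain t2 s2 where "exec b c' s1 t2 s2" "Q (reg s2) (mem s2) (t + t1 + t2)"
    unfolding wp_def ram_state_eta by blast
  with 1(1) show "wp b (Seq c c') Q r m t"
    unfolding wp_def exec_Seq_iff by (metis add.assoc)
qed

lemma wp_Cond [simp]:
  "wp b (Cond e c c') Q r m t \<longleftrightarrow>
     (if holds e \<lparr>reg = r, mem = m\<rparr> then wp b c Q r m (t + 1) else wp b c' Q r m (t + 1))"
proof -
  have "wp b (Cond e c c') Q r m t \<longleftrightarrow> wp b c0 Q r m (t + 1)"
    if "\<And>t' s'. exec b (Cond e c c') \<lparr>reg = r, mem = m\<rparr> t' s' \<longleftrightarrow>
      (\<exists>t1. t' = 1 + t1 \<and> exec b c0 \<lparr>reg = r, mem = m\<rparr> t1 s')" for c0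
    unfolding wp_def that by (metis add.assoc)
  then show ?thesis
    by (simp add: exec_Cond_iff)
qed

text \<open>The counter \<open>k\<close> indexing the invariant also yields termination, and tying
  it to \<open>r x\<close> lets \<open>I\<close> alone decide the test. The \<open>t + 1\<close> in
  \<open>body\<close> and \<open>final\<close> pays for one evaluation of the test, the failing one
  included.\<close>

lemma wp_While_count:
  assumes init: "I 0 r m t"
    and count: "\<And>k r m t. k \<le> N \<Longrightarrow> I k r m t \<Longrightarrow> r x = k \<and> r y = N"
    and body: "\<And>k r m t. k < N \<Longrightarrow> I k r m t \<Longrightarrow> wp b c (I (Suc k)) r m (t + 1)"
    and final: "\<And>r m t. I N r m t \<Longrightarrow> Q r m (t + 1)"
  shows "wp b (While (Less x y) c) Q r m t"
proof -
  have "wp b (While (Less x y) c) Q r m t" if "k \<le> N" "I k r m t" for k r m t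
    using that
  \<comment> \<open>Induction downwards from \<open>N\<close>: the run from \<open>k\<close> is one
    round followed by the run from \<open>Suc k\<close>.\<close>
  proof (induction arbitrary: r m t rule: inc_induct)
    case base
    with count[OF _ base] have "\<not> holds (Less x y) \<lparr>reg = r, mem = m\<rparr>" by simp
    with final[OF base] show ?case
      unfolding wp_def using exec.WhileFalse by fastforce
  next
    case (step k)
    from step.hyps body[OF _ step.prems] obtain t1 s1
      where 1: "exec b c \<lparr>reg = r, mem = m\<rparr> t1 s1" "I (Suc k) (reg s1) (mem s1) (t + 1 + t1)"
      unfolding wp_def by auto
    from step.IH[OF 1(2)] obtain t2 s2
      where 2: "exec b (While (Less x y) c) s1 t2 s2" "Q (reg s2) (mem s2) (t + 1 + t1 + t2)"
      unfolding wp_def ram_state_eta by blast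
    have "r x = k \<and> r y = N" using count[OF _ step.prems] step.hyps by simp
    then have "exec b (While (Less x y) c) \<lparr>reg = r, mem = m\<rparr> (1 + t1 + t2) s2"
      using step.hyps by (intro exec.WhileTrue[OF _ 1(1) 2(1)]) simp
    with 2(2) show ?case
      unfolding wp_def by (metis add.assoc)
  qed
  from this[of 0, OF _ init] show ?thesis by simp
qed

lemma decides_withinI:
  assumes "wp b p (\<lambda>r m t. t \<le> T \<and> r 0 = (if Q then 1 else 0))
             (\<lambda>_. 0) (\<lambda>a. if a < length xs then xs ! a else 0) 0"
  shows "decides_within b p xs Q T"
  using assms unfolding wp_def decides_within_def initial_state_def by auto

section \<open>Positions in a list\<close>

definition position :: "'a list \<Rightarrow> 'a \<Rightarrow> nat" where
  "position xs x = (THE p. p < length xs \<and> xs ! p = x)"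

lemma position_nth: "distinct xs \<Longrightarrow> p < length xs \<Longrightarrow> position xs (xs ! p) = p"
  unfolding position_def by (rule the_equality) (auto simp: nth_eq_iff_index_eq)

lemma position_less: "distinct xs \<Longrightarrow> x \<in> set xs \<Longrightarrow> position xs x < length xs"
  by (metis in_set_conv_nth position_nth)

lemma nth_position: "distinct xs \<Longrightarrow> x \<in> set xs \<Longrightarrow> xs ! position xs x = x"
  by (metis in_set_conv_nth position_nth)

text \<open>Distinctness makes the two witnessing indices unique, so preference becomes a comparison
  of numbers that a program can store.\<close>

lemma appears_before_iff:
  assumes "distinct xs" "x \<in> set xs" "y \<in> set xs"
  shows "appears_before x y xs \<longleftrightarrow> position xs x < position xs y"
proof
  assume "appears_before x y xs"
  then show "position xs x < position xs y"
    unfolding appears_before_def using assms(1) by (auto simp: position_nth)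
next
  assume "position xs x < position xs y"
  then show "appears_before x y xs"
    unfolding appears_before_def
    using position_less[OF assms(1,3)] nth_position[OF assms(1)] assms(2,3) by blast
qed

lemma row_index_less: "i < d \<Longrightarrow> p < n \<Longrightarrow> i * n + p < d * (n :: nat)"
proof -
  assume "i < d" "p < n"
  then have "i * n + p < Suc i * n" by simp
  also have "\<dots> \<le> d * n" using \<open>i < d\<close> by (intro mult_le_mono1) simp
  finally show ?thesis .
qed

lemma length_concat_rows: "(\<And>i. i < d \<Longrightarrow> length (f i) = n) \<Longrightarrow> length (concat (map f [0..<d])) = d * n"
  by (induction d) auto

lemma nth_concat_rows:
  assumes "\<And>i. i < d \<Longrightarrow> length (f i) = n" "i < d" "p < n"
  shows "concat (map f [0..<d]) ! (i * n + p) = f i ! p"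
  using assms
proof (induction d)
  case (Suc d)
  have len: "length (concat (map f [0..<d])) = d * n"
    using Suc.prems(1) by (intro length_concat_rows) simp
  show ?case
  proof (cases "i = d")
    case True
    with len show ?thesis by (simp add: nth_append)
  next
    case False
    with Suc.prems have "i < d" by simp
    moreover from this Suc.prems(3) have "i * n + p < length (concat (map f [0..<d]))"
      unfolding len by (rule row_index_less)
    moreover have "concat (map f [0..<d]) ! (i * n + p) = f i ! p"
      using Suc.prems \<open>i < d\<close> by (intro Suc.IH) auto
    ultimately show ?thesis by (simp add: nth_append)
  qed
qed simp

section \<open>The program\<close>

abbreviation (input) "r_ans \<equiv> 0 :: reg_name"
abbreviation (input) "r_one \<equiv> 2 :: reg_name"
abbreviation (input) "r_n \<equiv> 3 :: reg_name"
abbreviation (input) "r_d \<equiv> 4 :: reg_name"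
abbreviation (input) "r_size \<equiv> 5 :: reg_name"
abbreviation (input) "r_men \<equiv> 6 :: reg_name"
abbreviation (input) "r_manlist \<equiv> 7 :: reg_name"
abbreviation (input) "r_womanlist \<equiv> 8 :: reg_name"
abbreviation (input) "r_match \<equiv> 9 :: reg_name"
abbreviation (input) "r_partner \<equiv> 10 :: reg_name"
abbreviation (input) "r_rows \<equiv> 11 :: reg_name"
abbreviation (input) "r_rank \<equiv> 12 :: reg_name"
abbreviation (input) "r_best \<equiv> 13 :: reg_name"
abbreviation (input) "r_i \<equiv> 14 :: reg_name"
abbreviation (input) "r_j \<equiv> 15 :: reg_name"
abbreviation (input) "r_p \<equiv> 16 :: reg_name"
abbreviation (input) "r_w \<equiv> 17 :: reg_name"
abbreviation (input) "r_m \<equiv> 18 :: reg_name"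
abbreviation (input) "r_a \<equiv> 19 :: reg_name"
abbreviation (input) "r_v \<equiv> 20 :: reg_name"
abbreviation (input) "r_u \<equiv> 21 :: reg_name"
abbreviation (input) "r_row \<equiv> 22 :: reg_name"
abbreviation (input) "r_q \<equiv> 23 :: reg_name"
abbreviation (input) "r_end \<equiv> 24 :: reg_name"
abbreviation (input) "r_c \<equiv> 25 :: reg_name"

text \<open>The first load uses r_i as address 0 and the loop uses r_size and r_i as counters: all registers
  are initially 0.\<close>

definition setup_code :: com where
  "setup_code =
     Const r_one 1 ;; Load r_n r_i ;; Load r_d r_one ;;
     While (Less r_i r_d) (Add r_size r_size r_n ;; Add r_i r_i r_one) ;;
     Const r_men 2 ;; Add r_men r_men r_size ;; Add r_manlist r_men r_size ;;
     Add r_womanlist r_manlist r_n ;; Add r_match r_womanlist r_n ;; Add r_partner r_match r_n ;;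
     Add r_rows r_partner r_n ;; Add r_rank r_rows r_d ;; Add r_best r_rank r_size"

definition invert_code :: com where
  "invert_code =
     Const r_m 0 ;;
     While (Less r_m r_n)
       (Add r_a r_match r_m ;; Load r_w r_a ;; Add r_a r_partner r_w ;; Store r_a r_m ;;
        Add r_m r_m r_one)"

definition row_code :: com where
  "row_code =
     Const r_p 0 ;;
     While (Less r_p r_n)
       (Load r_m r_men ;; Add r_a r_row r_m ;; Store r_a r_p ;; Add r_men r_men r_one ;;
        Add r_p r_p r_one)"

text \<open>Besides the matrix of ranks, a directory of its row addresses is filled: without
  multiplication a probe could not find an arbitrary row in constant time.\<close>

definition rank_code :: com where
  "rank_code =
     Const r_j 0 ;; Move r_row r_rank ;;
     While (Less r_j r_d)
       (Add r_a r_rows r_j ;; Store r_a r_row ;; row_code ;; Add r_row r_row r_n ;;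
        Add r_j r_j r_one)"

text \<open>The value \<open>n\<close> exceeds every rank and stands for infinity. A list shared by
  several women is simply cleared several times.\<close>

definition reset_code :: com where
  "reset_code =
     Const r_w 0 ;;
     While (Less r_w r_n)
       (Add r_a r_womanlist r_w ;; Load r_j r_a ;; Add r_a r_best r_j ;; Store r_a r_n ;;
        Add r_w r_w r_one)"

text \<open>The ranks of one man form a column of the rank matrix, hence the stride \<open>n\<close>
  of the pointer \<open>r_row\<close>.\<close>

definition update_code :: com where
  "update_code =
     Add r_row r_rank r_m ;; Move r_c r_best ;; Const r_j 0 ;;
     While (Less r_j r_d)
       (Load r_v r_row ;; Load r_u r_c ;; Cond (Less r_v r_u) (Store r_c r_v) Skip ;;
        Add r_row r_row r_n ;; Add r_c r_c r_one ;; Add r_j r_j r_one)"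

definition probe_code :: com where
  "probe_code =
     Sub r_q r_q r_one ;; Load r_w r_q ;;
     Add r_a r_partner r_w ;; Load r_m r_a ;;
     Add r_a r_womanlist r_w ;; Load r_j r_a ;;
     Add r_a r_best r_j ;; Load r_u r_a ;;
     Add r_a r_rows r_j ;; Load r_row r_a ;; Add r_a r_row r_m ;; Load r_v r_a ;;
     Cond (Less r_u r_v) (Const r_ans 0) Skip ;;
     Add r_a r_manlist r_m ;; Load r_j r_a"

text \<open>\<open>r_end\<close> grows by \<open>n\<close> per list, which replaces a
  multiplication. \<open>r_q\<close> starts one cell past the row because \<open>probe_code\<close>
  decrements before it reads; the probe also leaves the list index of the partner in
  \<open>r_j\<close> for the conditional.\<close>

definition sweep_row_code :: com where
  "sweep_row_code =
     reset_code ;; Add r_end r_end r_n ;; Move r_q r_end ;; Const r_p 0 ;;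
     While (Less r_p r_n)
       (probe_code ;; Cond (Equal r_j r_i) update_code Skip ;; Add r_p r_p r_one)"

definition sweep_code :: com where
  "sweep_code =
     Const r_ans 1 ;; Const r_i 0 ;; Const r_end 2 ;;
     While (Less r_i r_d) (sweep_row_code ;; Add r_i r_i r_one)"

definition stability_code :: com where
  "stability_code = setup_code ;; invert_code ;; rank_code ;; sweep_code"

section \<open>Correctness and running time\<close>

locale matching_instance =
  fixes n d :: nat and M :: market and \<mu> :: "nat \<Rightarrow> nat" and b :: nat
  assumes n_pos: "n \<ge> 1"
    and market: "d_list_market n d M"
    and matching: "perfect_matching n \<mu>"
    and word_size: "16 * (d * n) \<le> 2 ^ b"
begin

section \<open>Rankings and partners in a fixed instance\<close>

abbreviation "\<pi> \<equiv> women_ranking M"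
abbreviation "\<sigma> \<equiv> men_ranking M"
abbreviation "mlist \<equiv> man_list M"
abbreviation "wlist \<equiv> woman_list M"
abbreviation "partner \<equiv> partner_of_woman n \<mu>"

lemma d_pos: "d \<ge> 1"
proof -
  have "man_list M 0 < d" using n_pos market unfolding d_list_market_def by simp
  then show ?thesis by simp
qed

lemma n_le: "n \<le> d * n" and d_le: "d \<le> d * n" and dn_pos: "1 \<le> d * n"
  using n_pos d_pos by simp_all

lemma length_ranking: "ranking n xs \<Longrightarrow> length xs = n"
  unfolding ranking_def by (metis card_lessThan distinct_card)

lemma ranking_\<pi>: "i < d \<Longrightarrow> ranking n (\<pi> i)" and ranking_\<sigma>: "i < d \<Longrightarrow> ranking n (\<sigma> i)"
  using market unfolding d_list_market_def by auto

lemma \<pi>_simps: "i < d \<Longrightarrow> distinct (\<pi> i)" "i < d \<Longrightarrow> set (\<pi> i) = {..<n}" "i < d \<Longrightarrow> length (\<pi> i) = n"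
  using ranking_\<pi>[of i] length_ranking[of "\<pi> i"] by (simp_all add: ranking_def)

lemma \<sigma>_simps: "i < d \<Longrightarrow> distinct (\<sigma> i)" "i < d \<Longrightarrow> set (\<sigma> i) = {..<n}" "i < d \<Longrightarrow> length (\<sigma> i) = n"
  using ranking_\<sigma>[of i] length_ranking[of "\<sigma> i"] by (simp_all add: ranking_def)

lemma mlist_less: "m < n \<Longrightarrow> mlist m < d" and wlist_less: "w < n \<Longrightarrow> wlist w < d"
  using market unfolding d_list_market_def by auto

lemma \<pi>_less: "i < d \<Longrightarrow> p < n \<Longrightarrow> \<pi> i ! p < n"
  and \<sigma>_less: "i < d \<Longrightarrow> p < n \<Longrightarrow> \<sigma> i ! p < n"
  using nth_mem[of p "\<pi> i"] nth_mem[of p "\<sigma> i"] by (simp_all add: \<pi>_simps \<sigma>_simps)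

lemma \<mu>_less: "m < n \<Longrightarrow> \<mu> m < n"
  using matching unfolding perfect_matching_def by (auto dest: bij_betwE)

lemma partner_less: "w < n \<Longrightarrow> partner w < n"
  and \<mu>_partner: "w < n \<Longrightarrow> \<mu> (partner w) = w"
  and partner_\<mu>: "m < n \<Longrightarrow> partner (\<mu> m) = m"
proof -
  have inj: "inj_on \<mu> {..<n}" and img: "\<mu> ` {..<n} = {..<n}"
    using matching unfolding perfect_matching_def bij_betw_def by auto
  show "partner w < n" "\<mu> (partner w) = w" if "w < n"
    using inv_into_into[of w \<mu> "{..<n}"] f_inv_into_f[of w \<mu> "{..<n}"] that img
    unfolding partner_of_woman_def by simp_all
  show "partner (\<mu> m) = m" if "m < n"
    using inv_into_f_f[OF inj] that unfolding partner_of_woman_def by simp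
qed

section \<open>Memory layout\<close>

definition input :: "nat \<Rightarrow> nat" where
  "input a = encode_input n d M \<mu> ! a"

definition "women_at = (2 :: nat)"
definition "men_at = women_at + d * n"
definition "manlist_at = men_at + d * n"
definition "womanlist_at = manlist_at + n"
definition "match_at = womanlist_at + n"
definition "partner_at = match_at + n"
definition "rows_at = partner_at + n"
definition "rank_at = rows_at + d"
definition "best_at = rank_at + d * n"

lemmas at_defs = women_at_def men_at_def manlist_at_def womanlist_at_def match_at_def partner_at_def
  rows_at_def rank_at_def best_at_def

text \<open>With \<open>d * n\<close> as an atom, later questions of disjointness and overflow
  become linear arithmetic. The sum bounded by \<open>2 ^ b\<close> equals
  \<open>2 + 4 * (d * n) + 4 * n + 2 * d\<close>, at most \<open>12 * (d * n)\<close>; its last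
  \<open>d * n\<close> is spare room for pointers that step past their table.\<close>

lemma at_le:
  "2 \<le> women_at" "women_at + d * n \<le> men_at" "men_at + d * n \<le> manlist_at" "manlist_at + n \<le> womanlist_at"
  "womanlist_at + n \<le> match_at" "match_at + n \<le> partner_at" "partner_at + n \<le> rows_at"
  "rows_at + d \<le> rank_at" "rank_at + d * n \<le> best_at" "best_at + d + d * n \<le> 2 ^ b"
  "n \<le> d * n" "d \<le> d * n"
  using word_size n_le d_le dn_pos unfolding at_defs by linarith+

lemma b_pos: "0 < b"
proof (rule ccontr)
  assume "\<not> 0 < b"
  then show False using word_size dn_pos by simp
qed

text \<open>The input ends where the partner table begins, so all cells from
  \<open>partner_at\<close> on start at 0 and are free for work.\<close>

lemma length_input: "length (encode_input n d M \<mu>) = partner_at"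
  unfolding encode_input_def by (simp add: length_concat_rows \<pi>_simps \<sigma>_simps at_defs)

lemma input_simps:
  "input 0 = n" "input (Suc 0) = d"
  "i < d \<Longrightarrow> p < n \<Longrightarrow> input (women_at + (i * n + p)) = \<pi> i ! p"
  "i < d \<Longrightarrow> p < n \<Longrightarrow> input (men_at + (i * n + p)) = \<sigma> i ! p"
  "m < n \<Longrightarrow> input (manlist_at + m) = mlist m"
  "m < n \<Longrightarrow> input (womanlist_at + m) = wlist m"
  "m < n \<Longrightarrow> input (match_at + m) = \<mu> m"
proof -
  define P where "P = concat (map \<pi> [0..<d])"
  define S where "S = concat (map \<sigma> [0..<d])"
  have len: "length P = d * n" "length S = d * n"
    unfolding P_def S_def by (simp_all add: length_concat_rows \<pi>_simps \<sigma>_simps)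
  have enc: "encode_input n d M \<mu> =
      [n, d] @ P @ S @ map mlist [0..<n] @ map wlist [0..<n] @ map \<mu> [0..<n]"
    unfolding encode_input_def P_def S_def ..
  show "input 0 = n" "input (Suc 0) = d"
    unfolding input_def enc by simp_all
  show "input (manlist_at + m) = mlist m" "input (womanlist_at + m) = wlist m"
    "input (match_at + m) = \<mu> m" if "m < n"
    using that unfolding input_def enc by (simp_all add: nth_append len at_defs)
  assume ip: "i < d" "p < n"
  note less = row_index_less[OF ip]
  have "P ! (i * n + p) = \<pi> i ! p" "S ! (i * n + p) = \<sigma> i ! p"
    unfolding P_def S_def using ip by (auto intro!: nth_concat_rows simp: \<pi>_simps \<sigma>_simps)
  then show "input (women_at + (i * n + p)) = \<pi> i ! p" "input (men_at + (i * n + p)) = \<sigma> i ! p"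
    using less unfolding input_def enc by (simp_all add: nth_append len at_defs)
qed

text \<open>These registers stay constant after the setup. \<open>r_men\<close> is absent because
  the ranking phase moves it as its read pointer.\<close>

definition layout :: "(reg_name \<Rightarrow> nat) \<Rightarrow> bool" where
  "layout r \<longleftrightarrow> r r_one = 1 \<and> r r_n = n \<and> r r_d = d \<and> r r_manlist = manlist_at \<and>
     r r_womanlist = womanlist_at \<and> r r_match = match_at \<and> r r_partner = partner_at \<and>
     r r_rows = rows_at \<and> r r_rank = rank_at \<and> r r_best = best_at"

section \<open>Setup, inverse matching and rank matrix\<close>

lemma setup_wp:
  assumes r: "\<And>z. r z = 0" and m: "m 0 = n" "m 1 = d"
    and Q: "\<And>r' t'. layout r' \<Longrightarrow> r' r_men = men_at \<Longrightarrow> t' \<le> t + (3 * d + 13) \<Longrightarrow> Q r' m t'"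
  shows "wp b setup_code Q r m t"
proof -
  have fits: "n < 2 ^ b" "d < 2 ^ b" "2 < (2::nat) ^ b"
    using at_le n_pos by linarith+
  show ?thesis
    unfolding setup_code_def
    apply (simp add: r m m[unfolded One_nat_def] b_pos fits)
    apply (rule wp_While_count[where N = d and I = "\<lambda>k r' m' t'. m' = m \<and> r' r_one = 1 \<and> r' r_n = n \<and>
        r' r_d = d \<and> r' r_size = k * n \<and> r' r_i = k \<and> t' \<le> t + 3 + 3 * k"])
    subgoal by (simp add: r)
    subgoal by simp
    subgoal for k r' m' t'
      using mult_le_mono1[of "Suc k" d n] at_le by (simp add: add.commute)
    subgoal for r' m' t'
    proof -
      assume I: "m' = m \<and> r' r_one = 1 \<and> r' r_n = n \<and> r' r_d = d \<and> r' r_size = d * n \<and> r' r_i = d \<and>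
        t' \<le> t + 3 + 3 * d"
      have bounds: "men_at < 2 ^ b" "manlist_at < 2 ^ b" "womanlist_at < 2 ^ b" "match_at < 2 ^ b"
        "partner_at < 2 ^ b" "rows_at < 2 ^ b" "rank_at < 2 ^ b" "best_at < 2 ^ b"
        using at_le n_pos by linarith+
      have addresses: "2 mod 2 ^ b = women_at" "(women_at + d * n) mod 2 ^ b = men_at"
        "(men_at + d * n) mod 2 ^ b = manlist_at" "(manlist_at + n) mod 2 ^ b = womanlist_at"
        "(womanlist_at + n) mod 2 ^ b = match_at" "(match_at + n) mod 2 ^ b = partner_at"
        "(partner_at + n) mod 2 ^ b = rows_at" "(rows_at + d) mod 2 ^ b = rank_at"
        "(rank_at + d * n) mod 2 ^ b = best_at"
        using fits bounds by (simp_all add: at_defs(2-)[symmetric]) (simp add: women_at_def)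
      show ?thesis
        using I by (simp add: addresses) (rule Q; simp add: layout_def)
    qed
    done
qed

text \<open>Injectivity of \<open>\<mu>\<close> keeps later stores from overwriting earlier entries,
  and surjectivity makes the entries reach every woman.\<close>

lemma invert_wp:
  assumes r: "layout r" and m: "\<forall>a<partner_at. m a = input a"
    and Q: "\<And>r' m' t'. (\<And>z. z \<notin> {r_m, r_a, r_w} \<Longrightarrow> r' z = r z) \<Longrightarrow>
      (\<And>a. a < partner_at \<or> rows_at \<le> a \<Longrightarrow> m' a = m a) \<Longrightarrow>
      (\<And>w. w < n \<Longrightarrow> m' (partner_at + w) = partner w) \<Longrightarrow>
      t' \<le> t + (6 * n + 2) \<Longrightarrow> Q r' m' t'"
  shows "wp b invert_code Q r m t"
proof -
  let ?I = "\<lambda>k r' m' t'. (\<forall>z. z \<notin> {r_m, r_a, r_w} \<longrightarrow> r' z = r z) \<and> r' r_m = k \<and>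
      (\<forall>a. a < partner_at \<or> rows_at \<le> a \<longrightarrow> m' a = m a) \<and>
      (\<forall>x<k. m' (partner_at + \<mu> x) = x) \<and> t' \<le> t + (6 * k + 1)"
  show ?thesis
    unfolding invert_code_def
    apply simp
    apply (rule wp_While_count[where N = n and I = ?I])
    subgoal by simp
    subgoal using r by (simp add: layout_def)
    subgoal for k r' m' t'
    proof -
      assume k: "k < n" and I: "?I k r' m' t'"
      have \<mu>k: "\<mu> k < n" using k by (rule \<mu>_less)
      have load: "m' (match_at + k) = \<mu> k"
        using I m k at_le by (simp add: input_simps)
      have "\<mu> x \<noteq> \<mu> k" if "x < k" for x
        using that k partner_\<mu>[of x] partner_\<mu>[of k] by auto
      then have new: "\<forall>x<Suc k. (m'(partner_at + \<mu> k := k)) (partner_at + \<mu> x) = x"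
        using I by (simp add: less_Suc_eq)
      have frame: "\<forall>a. a < partner_at \<or> rows_at \<le> a \<longrightarrow> (m'(partner_at + \<mu> k := k)) a = m a"
        using I \<mu>k at_le by simp
      have regs: "r' r_n = n" "r' r_one = 1" "r' r_match = match_at" "r' r_partner = partner_at"
        using I r by (simp_all add: layout_def)
      have bounds: "\<mu> k < 2 ^ b" "match_at + k < 2 ^ b" "partner_at + \<mu> k < 2 ^ b" "k + 1 < 2 ^ b"
        using \<mu>k k at_le by linarith+
      show ?thesis
        using I new frame bounds load by (simp add: regs)
    qed
    subgoal for r' m' t'
    proof (rule Q)
      fix w assume I: "?I n r' m' t'" and "w < n"
      then show "m' (partner_at + w) = partner w"
        using \<mu>_partner[of w] partner_less[of w] by metis
    qed auto
    done
qed

definition ranks :: "nat \<Rightarrow> (nat \<Rightarrow> nat) \<Rightarrow> bool" where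
  "ranks k m \<longleftrightarrow> (\<forall>j<k. m (rows_at + j) = rank_at + j * n) \<and>
     (\<forall>j<k. \<forall>x<n. m (rank_at + (j * n + x)) = position (\<sigma> j) x)"

lemma row_wp:
  assumes r: "layout r" "r r_men = men_at + j * n" "r r_row = rank_at + j * n" and j: "j < d"
    and m: "\<forall>a<partner_at. m a = input a"
    and Q: "\<And>r' m' t'. (\<And>z. z \<notin> {r_m, r_a, r_p, r_men} \<Longrightarrow> r' z = r z) \<Longrightarrow> r' r_men = men_at + j * n + n \<Longrightarrow>
      (\<And>a. a < rank_at + j * n \<or> rank_at + j * n + n \<le> a \<Longrightarrow> m' a = m a) \<Longrightarrow>
      (\<And>x. x < n \<Longrightarrow> m' (rank_at + (j * n + x)) = position (\<sigma> j) x) \<Longrightarrow>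
      t' \<le> t + (6 * n + 2) \<Longrightarrow> Q r' m' t'"
  shows "wp b row_code Q r m t"
proof -
  let ?I = "\<lambda>k r' m' t'. (\<forall>z. z \<notin> {r_m, r_a, r_p, r_men} \<longrightarrow> r' z = r z) \<and> r' r_p = k \<and>
      r' r_men = men_at + (j * n + k) \<and>
      (\<forall>a. a < rank_at + j * n \<or> rank_at + j * n + n \<le> a \<longrightarrow> m' a = m a) \<and>
      (\<forall>p<k. m' (rank_at + (j * n + \<sigma> j ! p)) = p) \<and> t' \<le> t + (6 * k + 1)"
  have jn: "j * n + n \<le> d * n"
    using mult_le_mono1[of "Suc j" d n] j by simp
  show ?thesis
    unfolding row_code_def
    apply simp
    apply (rule wp_While_count[where N = n and I = ?I])
    subgoal using r by simp
    subgoal using r by (simp add: layout_def)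
    subgoal for k r' m' t'
    proof -
      assume k: "k < n" and I: "?I k r' m' t'"
      have \<sigma>k: "\<sigma> j ! k < n" using j k by (rule \<sigma>_less)
      have load: "m' (men_at + (j * n + k)) = \<sigma> j ! k"
        using I m k j jn at_le by (simp add: input_simps)
      have "\<sigma> j ! p \<noteq> \<sigma> j ! k" if "p < k" for p
        using that k j by (simp add: nth_eq_iff_index_eq \<sigma>_simps)
      then have new: "\<forall>p<Suc k. (m'(rank_at + (j * n + \<sigma> j ! k) := k)) (rank_at + (j * n + \<sigma> j ! p)) = p"
        using I by (simp add: less_Suc_eq)
      have regs: "r' r_n = n" "r' r_one = 1" "r' r_row = rank_at + j * n"
        using I r by (simp_all add: layout_def)
      have bounds: "\<sigma> j ! k < 2 ^ b" "rank_at + j * n + \<sigma> j ! k < 2 ^ b" "men_at + (j * n + k) + 1 < 2 ^ b"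
        "k + 1 < 2 ^ b"
        using jn \<sigma>k k at_le by linarith+
      show ?thesis
        using I new bounds load \<sigma>k by (simp add: regs add.assoc)
    qed
    subgoal for r' m' t'
    proof (rule Q)
      fix x assume I: "?I n r' m' t'" and "x < n"
      then have "x \<in> set (\<sigma> j)" using j by (simp add: \<sigma>_simps)
      then show "m' (rank_at + (j * n + x)) = position (\<sigma> j) x"
        using I j nth_position[of "\<sigma> j" x] position_less[of "\<sigma> j" x] by (auto simp: \<sigma>_simps)
    qed auto
    done
qed

lemma ranks_cong:
  assumes "ranks k m" "k \<le> d" "\<And>a. rows_at \<le> a \<Longrightarrow> a < rows_at + k \<Longrightarrow> m' a = m a"
    "\<And>a. rank_at \<le> a \<Longrightarrow> a < rank_at + k * n \<Longrightarrow> m' a = m a"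
  shows "ranks k m'"
  using assms row_index_less[of _ k _ n] unfolding ranks_def by simp

lemma rank_wp:
  assumes r: "layout r" "r r_men = men_at" and m: "\<forall>a<partner_at. m a = input a"
    and Q: "\<And>r' m' t'. layout r' \<Longrightarrow> (\<And>a. a < rows_at \<or> best_at \<le> a \<Longrightarrow> m' a = m a) \<Longrightarrow>
      ranks d m' \<Longrightarrow> t' \<le> t + (d * (6 * n + 7) + 3) \<Longrightarrow> Q r' m' t'"
  shows "wp b rank_code Q r m t"
proof -
  let ?I = "\<lambda>k r' m' t'. layout r' \<and> r' r_j = k \<and> r' r_men = men_at + k * n \<and>
      r' r_row = rank_at + k * n \<and>
      (\<forall>a. a < rows_at \<or> best_at \<le> a \<longrightarrow> m' a = m a) \<and> ranks k m' \<and>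
      t' \<le> t + (k * (6 * n + 7) + 2)"
  show ?thesis
    unfolding rank_code_def
    apply simp
    apply (rule wp_While_count[where N = d and I = ?I])
    subgoal using r at_le n_pos by (simp add: layout_def ranks_def)
    subgoal by (simp add: layout_def)
    subgoal for k r' m' t'
    proof -
      assume k: "k < d" and I: "?I k r' m' t'"
      have kn: "k * n + n \<le> d * n"
        using mult_le_mono1[of "Suc k" d n] k by simp
      define m1 where "m1 = m'(rows_at + k := rank_at + k * n)"
      have regs: "r' r_n = n" "r' r_d = d" "r' r_one = 1" "r' r_rows = rows_at" "r' r_j = k"
          "r' r_row = rank_at + k * n"
        using I by (simp_all add: layout_def)
      have bounds: "rows_at + k < 2 ^ b" "rank_at + k * n + n < 2 ^ b" "k + 1 < 2 ^ b"
        using kn k at_le n_pos by linarith+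
      \<comment> \<open>The 3 units are the loop test and the two instructions that lead to
        \<open>m1\<close>.\<close>
      have "wp b (row_code ;; Add r_row r_row r_n ;; Add r_j r_j r_one) (?I (Suc k))
          (r'(r_a := rows_at + k)) m1 (t' + 3)"
        unfolding wp_Seq
      proof (rule row_wp[OF _ _ _ k], goal_cases)
        case 1 show ?case using I by (simp add: layout_def)
      next
        case 2 show ?case using I by simp
      next
        case 3 show ?case using I by simp
      next
        case 4 show ?case using I m at_le by (simp add: m1_def)
      next
        case (5 r2 m2 t2)
        have frame: "m2 a = m1 a" if "a < rank_at + k * n \<or> best_at \<le> a" for a
          using 5(3)[of a] that kn at_le by linarith
        have "ranks k m2"
          using I k at_le by (intro ranks_cong[of k m' m2]) (auto simp: frame m1_def)
        moreover have "m2 (rows_at + k) = rank_at + k * n"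
          using k at_le by (simp add: frame m1_def)
        ultimately have "ranks (Suc k) m2"
          using 5(4) by (simp add: ranks_def less_Suc_eq all_conj_distrib)
        moreover have "m2 a = m a" if "a < rows_at \<or> best_at \<le> a" for a
        proof -
          have "m2 a = m1 a" using that at_le by (intro frame) linarith
          also have "\<dots> = m a" using that I k at_le by (auto simp: m1_def)
          finally show ?thesis .
        qed
        ultimately show ?case
          using 5(2,5) I bounds by (simp add: layout_def 5(1) regs add.assoc add.commute)
      qed
      then show ?thesis
        using bounds by (simp add: regs m1_def numeral_3_eq_3)
    qed
    subgoal for r' m' t'
      by (rule Q) auto
    done
qed

section \<open>Tables read and written during the sweep\<close>

definition tables :: "(nat \<Rightarrow> nat) \<Rightarrow> bool" where
  "tables m \<longleftrightarrow> (\<forall>a<partner_at. m a = input a) \<and> (\<forall>w<n. m (partner_at + w) = partner w) \<and> ranks d m"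

text \<open>The sweep writes only from \<open>best_at\<close> on, while all these tables lie below,
  so they survive each of its phases.\<close>

lemma tables_cong:
  assumes "tables m" "\<And>a. a < best_at \<Longrightarrow> m' a = m a"
  shows "tables m'"
proof -
  have "m' a = m a" if "a < partner_at + n" for a
    using assms(2) that at_le by simp
  moreover have "ranks d m'"
  proof (rule ranks_cong)
    show "ranks d m" using assms(1) unfolding tables_def by simp
  qed (use assms(2) at_le in simp_all)
  ultimately show ?thesis
    using assms(1) unfolding tables_def by simp
qed

lemma tablesD:
  assumes "tables m"
  shows "i < d \<Longrightarrow> p < n \<Longrightarrow> m (women_at + (i * n + p)) = \<pi> i ! p"
    and "x < n \<Longrightarrow> m (manlist_at + x) = mlist x"
    and "w < n \<Longrightarrow> m (womanlist_at + w) = wlist w"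
    and "w < n \<Longrightarrow> m (partner_at + w) = partner w"
    and "j < d \<Longrightarrow> m (rows_at + j) = rank_at + j * n"
    and "j < d \<Longrightarrow> x < n \<Longrightarrow> m (rank_at + (j * n + x)) = position (\<sigma> j) x"
proof -
  have inp: "m a = input a" if "a < partner_at" for a
    using assms that unfolding tables_def by simp
  show "m (women_at + (i * n + p)) = \<pi> i ! p" if "i < d" "p < n"
  proof -
    have "women_at + (i * n + p) < partner_at"
      using row_index_less[OF that] at_le by linarith
    then show ?thesis using that by (simp add: inp input_simps)
  qed
  show "m (manlist_at + x) = mlist x" if "x < n"
  proof -
    have "manlist_at + x < partner_at" using that at_le by linarith
    then show ?thesis using that by (simp add: inp input_simps)
  qed
  show "m (womanlist_at + w) = wlist w" if "w < n"
  proof -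
    have "womanlist_at + w < partner_at" using that at_le by linarith
    then show ?thesis using that by (simp add: inp input_simps)
  qed
qed (use assms in \<open>simp_all add: tables_def ranks_def\<close>)

lemma rank_less: "j < d \<Longrightarrow> x < n \<Longrightarrow> position (\<sigma> j) x < n"
  using position_less[of "\<sigma> j" x] by (simp add: \<sigma>_simps)

text \<open>Entries of the table at indices that no woman uses as her list are never reset, since clearing all
  d of them for every list would cost d * d steps; hence the second conjunct only speaks about
  the lists in use.\<close>

definition bests :: "nat set \<Rightarrow> (nat \<Rightarrow> nat) \<Rightarrow> bool" where
  "bests X m \<longleftrightarrow> (\<forall>j<d. m (best_at + j) \<le> n) \<and>
     (\<forall>w<n. \<forall>v\<le>n. m (best_at + wlist w) < v \<longleftrightarrow> (\<exists>x\<in>X. position (\<sigma> (wlist w)) x < v))"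

lemma reset_wp:
  assumes r: "layout r" and tabs: "tables m" and small: "\<forall>j<d. m (best_at + j) \<le> n"
    and Q: "\<And>r' m' t'. (\<And>z. z \<notin> {r_w, r_a, r_j} \<Longrightarrow> r' z = r z) \<Longrightarrow> tables m' \<Longrightarrow> bests {} m' \<Longrightarrow>
      t' \<le> t + (6 * n + 2) \<Longrightarrow> Q r' m' t'"
  shows "wp b reset_code Q r m t"
proof -
  let ?I = "\<lambda>k r' m' t'. (\<forall>z. z \<notin> {r_w, r_a, r_j} \<longrightarrow> r' z = r z) \<and> r' r_w = k \<and>
      (\<forall>a<best_at. m' a = m a) \<and> (\<forall>j<d. m' (best_at + j) \<le> n) \<and>
      (\<forall>w<k. m' (best_at + wlist w) = n) \<and> t' \<le> t + (6 * k + 1)"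
  show ?thesis
    unfolding reset_code_def
    apply simp
    apply (rule wp_While_count[where N = n and I = ?I])
    subgoal using small by simp
    subgoal using r by (simp add: layout_def)
    subgoal for k r' m' t'
    proof -
      assume k: "k < n" and I: "?I k r' m' t'"
      have j: "wlist k < d" using k by (rule wlist_less)
      have load: "m' (womanlist_at + k) = wlist k"
        using I tablesD(3)[OF tabs k] k at_le by simp
      have regs: "r' r_n = n" "r' r_one = 1" "r' r_womanlist = womanlist_at" "r' r_best = best_at"
        using I r by (simp_all add: layout_def)
      have bounds: "womanlist_at + k < 2 ^ b" "wlist k < 2 ^ b" "best_at + wlist k < 2 ^ b" "k + 1 < 2 ^ b"
        using j k at_le by linarith+
      have "\<forall>w<Suc k. (m'(best_at + wlist k := n)) (best_at + wlist w) = n"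
        using I by (simp add: less_Suc_eq)
      then show ?thesis
        using I bounds load by (simp add: regs)
    qed
    subgoal for r' m' t'
    proof (rule Q, goal_cases)
      case 2
      then show ?case using tables_cong[OF tabs, of m'] by simp
    next
      case 3
      \<comment> \<open>No threshold \<open>v \<le> n\<close> lies above the stored
        \<open>n\<close>, which is what the empty set demands.\<close>
      then show ?case by (simp add: bests_def)
    qed auto
    done
qed

text \<open>A minimum is below \<open>v\<close> iff one of its arguments is. Describing the table by
  thresholds thus turns \<open>min\<close> into insertion, with no minimum over a possibly empty
  set.\<close>

lemma bests_insert:
  assumes "bests X m" and x: "x < n"
    and m': "\<And>j. j < d \<Longrightarrow> m' (best_at + j) = min (m (best_at + j)) (position (\<sigma> j) x)"
  shows "bests (insert x X) m'"
  using assms(1) wlist_less rank_less[OF _ x]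
  unfolding bests_def by (auto simp: m' min_less_iff_disj min_le_iff_disj)

lemma update_wp:
  assumes r: "layout r" "r r_m = x" "x < n" and tabs: "tables m" and bests: "bests X m"
    and Q: "\<And>r' m' t'. (\<And>z. z \<notin> {r_row, r_c, r_j, r_v, r_u} \<Longrightarrow> r' z = r z) \<Longrightarrow> tables m' \<Longrightarrow>
      bests (insert x X) m' \<Longrightarrow> t' \<le> t + (8 * d + 4) \<Longrightarrow> Q r' m' t'"
  shows "wp b update_code Q r m t"
proof -
  let ?I = "\<lambda>k r' m' t'. (\<forall>z. z \<notin> {r_row, r_c, r_j, r_v, r_u} \<longrightarrow> r' z = r z) \<and> r' r_j = k \<and>
      r' r_row = rank_at + (k * n + x) \<and> r' r_c = best_at + k \<and> (\<forall>a<best_at. m' a = m a) \<and>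
      (\<forall>j<k. m' (best_at + j) = min (m (best_at + j)) (position (\<sigma> j) x)) \<and>
      (\<forall>j\<ge>k. m' (best_at + j) = m (best_at + j)) \<and> t' \<le> t + (8 * k + 3)"
  have bounds0: "rank_at + x < 2 ^ b" "best_at < 2 ^ b"
    using r at_le n_pos by linarith+
  have regs0: "r r_rank = rank_at" "r r_best = best_at"
    using r by (simp_all add: layout_def)
  show ?thesis
    unfolding update_code_def
    apply (simp add: regs0 bounds0 r)
    apply (rule wp_While_count[where N = d and I = ?I])
    subgoal by simp
    subgoal using r by (simp add: layout_def)
    subgoal for k r' m' t'
    proof -
      assume k: "k < d" and I: "?I k r' m' t'"
      have kn: "k * n + n \<le> d * n"
        using mult_le_mono1[of "Suc k" d n] k by simp
      have load: "m' (rank_at + (k * n + x)) = position (\<sigma> k) x"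
        using I tablesD(6)[OF tabs k] r kn at_le by simp
      have load': "m' (best_at + k) = m (best_at + k)"
        using I by simp
      have regs: "r' r_n = n" "r' r_one = 1"
        using I r by (simp_all add: layout_def)
      \<comment> \<open>Stale entries of lists that no woman uses are loaded too; the bound keeps
        them within a word.\<close>
      have "m (best_at + k) \<le> n" using bests k unfolding bests_def by simp
      then have bounds: "position (\<sigma> k) x < 2 ^ b" "m (best_at + k) < 2 ^ b"
        "rank_at + (k * n + x) + n < 2 ^ b" "best_at + k + 1 < 2 ^ b" "k + 1 < 2 ^ b"
        using rank_less[OF k r(3)] kn k at_le r n_pos by linarith+
      have step: "(rank_at + (k * n + x) + n) mod 2 ^ b = rank_at + (n + k * n + x)"
        using bounds(3) by simp
      show ?thesis
      proof (cases "position (\<sigma> k) x < m (best_at + k)")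
        case True
        then have "\<forall>j<Suc k. (m'(best_at + k := position (\<sigma> k) x)) (best_at + j) =
            min (m (best_at + j)) (position (\<sigma> j) x)"
          using I by (simp add: less_Suc_eq)
        then show ?thesis
          using I bounds True by (simp add: regs load load' step)
      next
        case False
        then have "\<forall>j<Suc k. m' (best_at + j) = min (m (best_at + j)) (position (\<sigma> j) x)"
          using I by (simp add: less_Suc_eq)
        then show ?thesis
          using I bounds False by (simp add: regs load load' step)
      qed
    qed
    subgoal for r' m' t'
    proof (rule Q, goal_cases)
      case 2
      then show ?case using tables_cong[OF tabs, of m'] by simp
    next
      case 3
      then show ?case using bests_insert[OF bests r(3), of m'] by simp
    qed auto
    done
qed

lemma probe_wp:
  assumes r: "layout r" "r r_q = women_at + (i * n + k) + 1" and tabs: "tables m" and bests: "bests X m"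
    and i: "i < d" and k: "k < n" and w: "w = \<pi> i ! k"
    and Q: "\<And>r' t'. (\<And>z. z \<notin> {r_ans, r_q, r_w, r_a, r_m, r_j, r_u, r_row, r_v} \<Longrightarrow> r' z = r z) \<Longrightarrow>
      r' r_q = women_at + (i * n + k) \<Longrightarrow> r' r_m = partner w \<Longrightarrow> r' r_j = mlist (partner w) \<Longrightarrow>
      r' r_ans = (if \<exists>y\<in>X. position (\<sigma> (wlist w)) y < position (\<sigma> (wlist w)) (partner w) then 0
        else r r_ans) \<Longrightarrow>
      t' = t + 16 \<Longrightarrow> Q r' m t'"
  shows "wp b probe_code Q r m t"
proof -
  define x where "x = partner w"
  define j where "j = wlist w"
  have w_less: "w < n" using i k by (simp add: w \<pi>_less)
  then have x: "x < n" and j: "j < d"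
    by (simp_all add: x_def j_def partner_less wlist_less)
  have i': "mlist x < d" using x by (rule mlist_less)
  have kn: "i * n + k < d * n" and jn: "j * n + x < d * n"
    using row_index_less i k j x by auto
  have loads: "m (women_at + (i * n + k)) = w" "m (partner_at + w) = x" "m (womanlist_at + w) = j"
    "m (rows_at + j) = rank_at + j * n" "m (rank_at + (j * n + x)) = position (\<sigma> j) x"
    "m (manlist_at + x) = mlist x"
    using tablesD[OF tabs] i k w_less x j by (simp_all add: w x_def j_def)
  have le: "m (best_at + j) \<le> n" using bests j unfolding bests_def by simp
  have pos: "position (\<sigma> j) x < n" using j x by (rule rank_less)
  have bounds: "women_at + (i * n + k) < 2 ^ b" "w < 2 ^ b" "partner_at + w < 2 ^ b" "x < 2 ^ b"
    "womanlist_at + w < 2 ^ b" "j < 2 ^ b" "best_at + j < 2 ^ b" "m (best_at + j) < 2 ^ b"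
    "rows_at + j < 2 ^ b" "rank_at + j * n < 2 ^ b" "rank_at + (j * n + x) < 2 ^ b"
    "position (\<sigma> j) x < 2 ^ b" "manlist_at + x < 2 ^ b" "mlist x < 2 ^ b"
    using kn jn w_less x j i' le pos at_le n_pos by linarith+
  have regs: "r r_one = 1" "r r_partner = partner_at" "r r_womanlist = womanlist_at"
    "r r_best = best_at" "r r_rows = rows_at" "r r_manlist = manlist_at"
    using r by (simp_all add: layout_def)
  \<comment> \<open>The threshold is the rank of the partner, below \<open>n\<close>; the list
    \<open>j\<close> is in use because \<open>w\<close> uses it.\<close>
  have test: "m (best_at + j) < position (\<sigma> j) x \<longleftrightarrow> (\<exists>y\<in>X. position (\<sigma> j) y < position (\<sigma> j) x)"
    using bests w_less pos unfolding bests_def j_def by simp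
  show ?thesis
    unfolding probe_code_def
    apply (simp add: regs r(2) loads bounds add.assoc)
    apply (intro conjI impI; rule Q; simp add: x_def[symmetric] j_def[symmetric] test[symmetric])
    done
qed

section \<open>Combinatorics of the backward sweep\<close>

text \<open>The second argument counts the steps of the sweep, which runs over the list backwards: after k steps the
  women at the last k positions have been passed.\<close>

definition seen :: "nat \<Rightarrow> nat \<Rightarrow> nat set" where
  "seen i k = (!) (\<pi> i) ` {n - k..<n}"

definition pool :: "nat \<Rightarrow> nat \<Rightarrow> nat set" where
  "pool i k = {x. x < n \<and> mlist x = i \<and> \<mu> x \<in> seen i k}"

text \<open>Each pair is charged to the man's list and to the moment its woman is passed, so that
  \<open>r_ans\<close> can record the negation throughout the sweep.\<close>

definition found :: "nat \<Rightarrow> nat \<Rightarrow> bool" where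
  "found i k \<longleftrightarrow> (\<exists>y<n. \<exists>w<n. blocking_pair n M \<mu> y w \<and> (mlist y < i \<or> mlist y = i \<and> w \<in> seen i k))"

text \<open>The cardinality of this set is the number of table updates so far.\<close>

definition done_men :: "nat \<Rightarrow> nat \<Rightarrow> nat set" where
  "done_men i k = {x. x < n \<and> mlist x < i} \<union> pool i k"

lemma seen_0: "seen i 0 = {}"
  by (simp add: seen_def)

lemma seen_n: "i < d \<Longrightarrow> seen i n = {..<n}"
  using \<pi>_simps[of i] by (simp add: seen_def atLeast0LessThan flip: set_conv_nth)
    (metis list.set_map map_nth set_upt atLeast0LessThan)

lemma seen_Suc: "k < n \<Longrightarrow> seen i (Suc k) = insert (\<pi> i ! (n - Suc k)) (seen i k)"
proof -
  assume "k < n"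
  then have "{n - Suc k..<n} = insert (n - Suc k) {n - k..<n}" by auto
  then show ?thesis by (simp add: seen_def)
qed

text \<open>Positions in a ranking are unique, so the range of passed indices becomes a comparison
  of positions, the form that \<open>appears_before_iff\<close> delivers.\<close>

lemma seen_iff:
  assumes "i < d" "k < n" "w < n"
  shows "w \<in> seen i k \<longleftrightarrow> position (\<pi> i) (\<pi> i ! (n - Suc k)) < position (\<pi> i) w"
proof -
  have w: "w \<in> set (\<pi> i)" using assms by (simp add: \<pi>_simps)
  have "position (\<pi> i) (\<pi> i ! (n - Suc k)) = n - Suc k"
    using assms by (intro position_nth) (simp_all add: \<pi>_simps)
  moreover have "w \<in> seen i k \<longleftrightarrow> n - k \<le> position (\<pi> i) w"
  proof
    assume "w \<in> seen i k"
    then obtain p where "n - k \<le> p" "p < n" "w = \<pi> i ! p"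
      unfolding seen_def by auto
    then show "n - k \<le> position (\<pi> i) w"
      using assms position_nth[of "\<pi> i" p] by (simp add: \<pi>_simps)
  next
    assume "n - k \<le> position (\<pi> i) w"
    moreover have "position (\<pi> i) w < n" "\<pi> i ! position (\<pi> i) w = w"
      using position_less[OF _ w] nth_position[OF _ w] assms by (simp_all add: \<pi>_simps)
    ultimately show "w \<in> seen i k"
      unfolding seen_def by (intro image_eqI[of _ _ "position (\<pi> i) w"]) simp_all
  qed
  ultimately show ?thesis using assms(2) by linarith
qed

context
  fixes i k w
  assumes i: "i < d" and k: "k < n" and w: "w = \<pi> i ! (n - Suc k)"
begin

lemma w_less: "w < n"
  using i k by (simp add: w \<pi>_less)

text \<open>The woman just passed has a single partner, so one conditional update per woman is
  enough.\<close>

lemma pool_Suc: "pool i (Suc k) = (if mlist (partner w) = i then insert (partner w) (pool i k) else pool i k)"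
proof (rule set_eqI)
  fix x
  show "x \<in> pool i (Suc k) \<longleftrightarrow>
      x \<in> (if mlist (partner w) = i then insert (partner w) (pool i k) else pool i k)"
  proof (cases "x = partner w")
    case True
    then show ?thesis
      using partner_less[OF w_less] \<mu>_partner[OF w_less] by (simp add: pool_def seen_Suc[OF k] w[symmetric])
  next
    case False
    then have "\<mu> x \<noteq> w" if "x < n"
      using partner_\<mu>[OF that] by metis
    then show ?thesis
      using False by (auto simp: pool_def seen_Suc[OF k] w[symmetric])
  qed
qed

text \<open>Since \<open>w\<close> has not been passed yet, her partner would enter as a new man,
  and the potential grows by one.\<close>

lemma partner_notin_pool: "partner w \<notin> pool i k"
  using seen_iff[OF i k w_less] by (simp add: pool_def \<mu>_partner[OF w_less] w[symmetric])

text \<open>Both \<open>y\<close> and the sweep use \<open>\<pi> i\<close>, so \<open>y\<close>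
  prefers \<open>w\<close> iff his partner has been passed. The condition
  \<open>\<mu> y \<noteq> w\<close> then follows, as \<open>w\<close> herself has not.\<close>

lemma blocking_pair_iff:
  assumes "y < n" "mlist y = i"
  shows "blocking_pair n M \<mu> y w \<longleftrightarrow>
    \<mu> y \<in> seen i k \<and> position (\<sigma> (wlist w)) y < position (\<sigma> (wlist w)) (partner w)"
proof -
  have "appears_before w (\<mu> y) (\<pi> i) \<longleftrightarrow> \<mu> y \<in> seen i k"
    using i w_less \<mu>_less[OF assms(1)] seen_iff[OF i k, of "\<mu> y"]
    by (subst appears_before_iff) (simp_all add: \<pi>_simps w)
  moreover have "appears_before y (partner w) (\<sigma> (wlist w)) \<longleftrightarrow>
      position (\<sigma> (wlist w)) y < position (\<sigma> (wlist w)) (partner w)"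
    using wlist_less[OF w_less] partner_less[OF w_less] assms(1)
    by (intro appears_before_iff) (simp_all add: \<sigma>_simps)
  moreover have "\<mu> y \<noteq> w" if "\<mu> y \<in> seen i k"
    using that seen_iff[OF i k w_less] w by auto
  ultimately show ?thesis
    using assms(2) by (auto simp: blocking_pair_def man_pref_def woman_pref_def)
qed

text \<open>Only pairs containing \<open>w\<close> can be new, and their men are drawn from
  \<open>pool i k\<close>; the second disjunct is the test made by the probe.\<close>

lemma found_Suc:
  "found i (Suc k) \<longleftrightarrow> found i k \<or>
     (\<exists>y\<in>pool i k. position (\<sigma> (wlist w)) y < position (\<sigma> (wlist w)) (partner w))"
proof -
  have "found i (Suc k) \<longleftrightarrow> found i k \<or> (\<exists>y<n. mlist y = i \<and> blocking_pair n M \<mu> y w)"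
    unfolding found_def seen_Suc[OF k] w[symmetric] insert_iff using w_less by blast
  also have "(\<exists>y<n. mlist y = i \<and> blocking_pair n M \<mu> y w) \<longleftrightarrow>
      (\<exists>y\<in>pool i k. position (\<sigma> (wlist w)) y < position (\<sigma> (wlist w)) (partner w))"
    unfolding pool_def using blocking_pair_iff by blast
  finally show ?thesis .
qed

lemma card_done_men_Suc:
  "card (done_men i (Suc k)) = card (done_men i k) + (if mlist (partner w) = i then 1 else 0)"
proof -
  have "finite (done_men i k)" unfolding done_men_def pool_def by simp
  moreover have "partner w \<notin> done_men i k" if "mlist (partner w) = i"
    using partner_notin_pool that unfolding done_men_def by simp
  moreover have "done_men i (Suc k) =
      (if mlist (partner w) = i then insert (partner w) (done_men i k) else done_men i k)"
    unfolding done_men_def pool_Suc by simp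
  ultimately show ?thesis by simp
qed

end

lemma pool_0: "pool i 0 = {}"
  by (simp add: pool_def seen_0)

lemma found_0: "\<not> found 0 0"
  by (simp add: found_def seen_0)

lemma found_next: "i < d \<Longrightarrow> found (Suc i) 0 \<longleftrightarrow> found i n"
  by (auto simp: found_def seen_0 seen_n less_Suc_eq)

lemma found_d: "found d 0 \<longleftrightarrow> \<not> stable_matching n M \<mu>"
  using mlist_less by (auto simp: found_def seen_0 stable_matching_def)

lemma card_done_men_next: "card (done_men i n) \<le> card (done_men (Suc i) 0)"
  by (rule card_mono) (auto simp: done_men_def pool_def)

lemma card_done_men_le: "card (done_men i k) \<le> n"
  using card_mono[of "{..<n}" "done_men i k"] by (auto simp: done_men_def pool_def)

section \<open>Amortized analysis of the sweep\<close>

text \<open>The cardinality terms on both sides express the growth of the potential without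
  subtraction: table updates are paid by the men who enter.\<close>

lemma sweep_row_wp:
  assumes r: "layout r" "r r_i = i" "r r_end = women_at + i * n" and i: "i < d"
    and ans: "r r_ans = (if found i 0 then 0 else 1)"
    and tabs: "tables m" and small: "\<forall>j<d. m (best_at + j) \<le> n"
    and Q: "\<And>r' m' t'. layout r' \<Longrightarrow> r' r_i = i \<Longrightarrow> r' r_end = women_at + (i * n + n) \<Longrightarrow>
      r' r_ans = (if found i n then 0 else 1) \<Longrightarrow> tables m' \<Longrightarrow> \<forall>j<d. m' (best_at + j) \<le> n \<Longrightarrow>
      t' + (8 * d + 4) * card (done_men i 0) \<le> t + (26 * n + 6) + (8 * d + 4) * card (done_men i n) \<Longrightarrow>
      Q r' m' t'"
  shows "wp b sweep_row_code Q r m t"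
  unfolding sweep_row_code_def wp_Seq
proof (rule reset_wp[OF r(1) tabs small], goal_cases)
  case (1 r1 m1 t1)
  have regs1: "r1 r_n = n" "r1 r_end = women_at + i * n" "layout r1" "r1 r_i = i"
      "r1 r_ans = (if found i 0 then 0 else 1)"
    using 1(1) r ans by (simp_all add: layout_def)
  have "i * n + n \<le> d * n" using mult_le_mono1[of "Suc i" d n] i by simp
  then have bounds1: "women_at + i * n + n < 2 ^ b"
    using at_le n_pos by linarith
  \<comment> \<open>The 20 steps per woman are the loop test, 16 for the probe, the conditional, its
    \<open>Skip\<close> and the counter.\<close>
  let ?I = "\<lambda>k r' m' t'. layout r' \<and> r' r_i = i \<and> r' r_end = women_at + (i * n + n) \<and> r' r_p = k \<and>
      r' r_q = women_at + (i * n + (n - k)) \<and> r' r_ans = (if found i k then 0 else 1) \<and>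
      tables m' \<and> bests (pool i k) m' \<and>
      t' + (8 * d + 4) * card (done_men i 0) \<le> t1 + 3 + 20 * k + (8 * d + 4) * card (done_men i k)"
  show ?case
    apply (simp add: regs1 bounds1)
    apply (rule wp_While_count[where N = n and I = ?I])
    subgoal using regs1 1(2,3) by (simp add: layout_def pool_0)
    subgoal by (simp add: layout_def)
    subgoal for k r' m' t'
    proof -
      assume k: "k < n" and I: "?I k r' m' t'"
      define w where "w = \<pi> i ! (n - Suc k)"
      note facts = pool_Suc[OF i k w_def] found_Suc[OF i k w_def] card_done_men_Suc[OF i k w_def]
      have x: "partner w < n"
        using w_less[OF i k w_def] by (rule partner_less)
      have q: "r' r_q = women_at + (i * n + (n - Suc k)) + 1"
        using I k by simp
      show ?thesis
        unfolding wp_Seq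
      proof (rule probe_wp[of r' i "n - Suc k" m' "pool i k" w], goal_cases)
        case (8 r2 t2)
        have k_bound: "k + 1 < 2 ^ b" using k at_le n_pos by linarith
        have regs2: "layout r2" "r2 r_i = i" "r2 r_end = women_at + (i * n + n)" "r2 r_p = k"
            "r2 r_one = 1"
          using I 8(1) by (simp_all add: layout_def)
        have ans2: "r2 r_ans = (if found i (Suc k) then 0 else 1)"
          using I by (simp add: 8(5) facts(2))
        show ?case
        proof (cases "mlist (partner w) = i")
          case True
          then have "holds (Equal r_j r_i) \<lparr>reg = r2, mem = m'\<rparr>"
            using 8(4) regs2 by simp
          moreover have "wp b update_code (wp b (Add r_p r_p r_one) (?I (Suc k))) r2 m' (t2 + 1)"
          proof (rule update_wp[OF regs2(1) 8(3) x, where X = "pool i k"], goal_cases)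
            case (3 r3 m3 t3)
            have "layout r3" "r3 r_i = i" "r3 r_end = women_at + (i * n + n)" "r3 r_p = k"
                "r3 r_one = 1" "r3 r_q = women_at + (i * n + (n - Suc k))"
                "r3 r_ans = (if found i (Suc k) then 0 else 1)"
              using regs2 ans2 8(2) 3(1) by (simp_all add: layout_def)
            moreover have "bests (pool i (Suc k)) m3"
              using 3(3) True by (simp add: facts(1))
            \<comment> \<open>This increment, multiplied by \<open>8 * d + 4\<close>, pays for the
              update.\<close>
            moreover have "card (done_men i (Suc k)) = card (done_men i k) + 1"
              using True by (simp add: facts(3))
            ultimately show ?case
              using 3(2,4) 8(6) I k_bound by (simp add: layout_def algebra_simps)
          qed (use I in auto)
          ultimately show ?thesis by simp
        next
          case False
          then have "\<not> holds (Equal r_j r_i) \<lparr>reg = r2, mem = m'\<rparr>"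
            using 8(4) regs2 by simp
          then show ?thesis
            using False regs2 ans2 8(2,6) I k_bound by (simp add: layout_def facts(1,3))
        qed
      qed (use I q i k in \<open>simp_all add: w_def\<close>)
    qed
    subgoal for r' m' t'
      using 1(4) by (intro Q) (auto simp: bests_def)
    done
qed

lemma sweep_wp:
  assumes r: "layout r" and tabs: "tables m" and small: "\<forall>j<d. m (best_at + j) \<le> n"
    and Q: "\<And>r' m' t'. r' r_ans = (if stable_matching n M \<mu> then 1 else 0) \<Longrightarrow>
      t' \<le> t + (d * (26 * n + 8) + (8 * d + 4) * n + 4) \<Longrightarrow> Q r' m' t'"
  shows "wp b sweep_code Q r m t"
proof -
  let ?I = "\<lambda>i r' m' t'. layout r' \<and> r' r_i = i \<and> r' r_end = women_at + i * n \<and>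
      r' r_ans = (if found i 0 then 0 else 1) \<and> tables m' \<and> (\<forall>j<d. m' (best_at + j) \<le> n) \<and>
      t' \<le> t + 3 + i * (26 * n + 8) + (8 * d + 4) * card (done_men i 0)"
  have two: "2 mod 2 ^ b = women_at"
    using at_le n_pos by (simp add: women_at_def)
  show ?thesis
    unfolding sweep_code_def
    apply (simp add: two b_pos)
    apply (rule wp_While_count[where N = d and I = ?I])
    subgoal using r tabs small by (simp add: layout_def found_0)
    subgoal by (simp add: layout_def)
    subgoal for i r' m' t'
    proof -
      assume i: "i < d" and I: "?I i r' m' t'"
      show ?thesis
        unfolding wp_Seq
      proof (rule sweep_row_wp[of r' i m'], goal_cases)
        case (8 r2 m2 t2)
        have regs: "r2 r_one = 1" using 8(1) by (simp add: layout_def)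
        have i_bound: "i + 1 < 2 ^ b" using i at_le n_pos by linarith
        \<comment> \<open>Passing to the next list does not lower the potential, so the bounds of
          successive lists telescope.\<close>
        have "(8 * d + 4) * card (done_men i n) \<le> (8 * d + 4) * card (done_men (Suc i) 0)"
          using card_done_men_next by (rule mult_le_mono2)
        then have "t2 + 1 \<le> t + 3 + Suc i * (26 * n + 8) + (8 * d + 4) * card (done_men (Suc i) 0)"
          using 8(7) I unfolding mult_Suc by linarith
        then show ?case
          using 8 i_bound regs by (simp add: layout_def found_next[OF i] add_ac)
      qed (use I i in auto)
    qed
    subgoal for r' m' t'
    proof -
      assume I: "?I d r' m' t'"
      \<comment> \<open>Each man counts once over all lists together, which limits the total cost of
        updates.\<close>
      have "(8 * d + 4) * card (done_men d 0) \<le> (8 * d + 4) * n"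
        using card_done_men_le by (rule mult_le_mono2)
      then have "t' + 1 \<le> t + (d * (26 * n + 8) + (8 * d + 4) * n + 4)"
        using I by linarith
      then show ?thesis
        using I by (intro Q) (simp_all add: found_d)
    qed
    done
qed

section \<open>The whole program\<close>

lemma stability_code_wp:
  assumes r: "\<And>z. r z = 0" and m: "\<And>a. m a = (if a < partner_at then input a else 0)"
    and Q: "\<And>r' m' t'. r' r_ans = (if stable_matching n M \<mu> then 1 else 0) \<Longrightarrow>
      t' \<le> t + 90 * (d * n) \<Longrightarrow> Q r' m' t'"
  shows "wp b stability_code Q r m t"
  unfolding stability_code_def wp_Seq
proof (rule setup_wp[OF r], goal_cases)
  case 1
  then show ?case using m[of 0] at_le by (simp add: input_simps)
next
  case 2
  then show ?case using m[of 1] at_le by (simp add: input_simps)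
next
  case init: (3 r1 t1)
  show ?case
  proof (rule invert_wp[OF init(1)], goal_cases)
    case 1
    show ?case by (simp add: m)
  next
    case invert: (2 r2 m2 t2)
    have m2: "\<forall>a<partner_at. m2 a = input a"
      using invert(2) by (simp add: m)
    have "layout r2" "r2 r_men = men_at"
      using init(1,2) invert(1) by (simp_all add: layout_def)
    then show ?case
    proof (rule rank_wp[OF _ _ m2], goal_cases)
      case rank: (1 r3 m3 t3)
      have "tables m3"
        using m2 invert(3) rank(2,3) at_le unfolding tables_def by simp
      \<comment> \<open>These cells still hold their initial 0.\<close>
      moreover have "\<forall>j<d. m3 (best_at + j) \<le> n"
        using rank(2) invert(2) at_le by (simp add: m)
      ultimately show ?case
      proof (rule sweep_wp[OF rank(1)], goal_cases)
        case sweep: (1 r4 m4 t4)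
        have "t4 \<le> t + (40 * (d * n) + 18 * d + 10 * n + 22)"
          using sweep(2) rank(4) invert(4) init(3) by (simp add: algebra_simps)
        \<comment> \<open>90 is 40 + 18 + 10 + 22, as \<open>d\<close>, \<open>n\<close> and 1 are
          all at most \<open>d * n\<close>.\<close>
        then have "t4 \<le> t + 90 * (d * n)"
          using n_le d_le dn_pos by linarith
        with sweep(1) show ?case by (rule Q)
      qed
    qed
  qed
qed

lemma stability_code_decides:
  "decides_within b stability_code (encode_input n d M \<mu>) (stable_matching n M \<mu>) (90 * (d * n))"
proof (rule decides_withinI, rule stability_code_wp)
  fix a
  show "(if a < length (encode_input n d M \<mu>) then encode_input n d M \<mu> ! a else 0) =
      (if a < partner_at then input a else 0)"
    by (simp add: length_input input_def)
qed simp_all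

end

theorem theorem5:
  "\<exists>(p :: com) (c :: nat) (k :: nat).
     \<forall>(n :: nat) (d :: nat) (M :: market) (\<mu> :: nat \<Rightarrow> nat) (b :: nat).
       n \<ge> 1 \<and> d_list_market n d M \<and> perfect_matching n \<mu> \<and> k * (d * n) \<le> 2 ^ b \<longrightarrow>
       decides_within b p (encode_input n d M \<mu>) (stable_matching n M \<mu>) (c * (d * n))"
proof (intro exI allI impI)
  fix n d M \<mu> b
  assume "n \<ge> 1 \<and> d_list_market n d M \<and> perfect_matching n \<mu> \<and> 16 * (d * n) \<le> 2 ^ b"
  then interpret matching_instance n d M \<mu> b
    by unfold_locales auto
  show "decides_within b stability_code (encode_input n d M \<mu>) (stable_matching n M \<mu>) (90 * (d * n))"
    by (rule stability_code_decides)
qed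

end
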